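(* If $p_n(\mathfrak{3D},k)$ is the number of ternary partitions of $k$ into distinct non-negative powers of three no greater than $3^n$ (that is, partitions of $k$ into distinct parts from $\{3^0,3^1,\dots,3^n\}$), then $$(1+q^1)(1+q^3)(1+q^9)\cdots(1+q^{3^n})=\sum_{k=0}^{3^{n+1}-1}p_n(\mathfrak{3D},k)q^k$$ $$=\cfrac{1}{1-\cfrac{q^1}{1+q^1-\cfrac{(1+q^1)q^3}{q^1+q^3+q^1q^3-\cfrac{(1+q^3)q^9}{q^3+q^9+q^3q^9-\ddots-\cfrac{(1+q^{3^{n-1}})q^{3^n}}{q^{3^{n-1}}+q^{3^n}+q^{3^{n-1}}q^{3^n}}}}}}.$$
   Formalization: The printed continued fraction fails for n = 2 (at q = 2 it gives 14715/289, not 13851); from the third on, the partial numerators are corrected to q^{3^{j}}(1+q^{3^{j+1}})q^{3^{j+2}}, j = 0, 1, …; for field values of q, the denominators must be nonzero. *)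

theory Defs
  imports Complex_Main "HOL-Library.Multiset" "HOL-Computational_Algebra.Polynomial"
    "HOL-Computational_Algebra.Fraction_Field"
begin

definition distinct_ternary_partitions :: "nat \<Rightarrow> nat \<Rightarrow> nat multiset set" where
  "distinct_ternary_partitions n k =
     {M. set_mset M \<subseteq> {3 ^ i | i. i \<le> n} \<and> (\<forall>x. count M x \<le> 1) \<and> sum_mset M = k}"

definition p3D :: "nat \<Rightarrow> nat \<Rightarrow> nat" where
  "p3D n k = card (distinct_ternary_partitions n k)"

text \<open>
  Finite continued fraction with minus signs: \<open>cf_tail a b k m\<close> is
  \<open>b k - a k / (b (k+1) - a (k+1) / ( ... - a (k+m-1) / b (k+m)))\<close>.
  So \<open>a k\<close> is the partial numerator standing below \<open>b k\<close>, over \<open>b (k+1)\<close>.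
\<close>

primrec cf_tail :: "(nat \<Rightarrow> 'a::field) \<Rightarrow> (nat \<Rightarrow> 'a) \<Rightarrow> nat \<Rightarrow> nat \<Rightarrow> 'a" where
  "cf_tail a b k 0 = b k"
| "cf_tail a b k (Suc m) = b k - a k / cf_tail a b (Suc k) m"

fun ternary_den :: "'a::field \<Rightarrow> nat \<Rightarrow> 'a" where
  "ternary_den q 0 = 1"
| "ternary_den q (Suc 0) = 1 + q ^ 1"
| "ternary_den q (Suc (Suc j)) = q ^ (3 ^ j) + q ^ (3 ^ (j + 1)) + q ^ (3 ^ j) * q ^ (3 ^ (j + 1))"

text \<open>
  These numerators come from Euler's continued fraction for
  \<open>c 0 + c 1 + c 2 + ...\<close> with \<open>c 0 = 1\<close> and
  \<open>c (i+1) = (1 + q^(3^0)) ... (1 + q^(3^(i-1))) q^(3^i)\<close>, whose partial sums are the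
  products \<open>(1 + q^(3^0)) ... (1 + q^(3^i))\<close>.  The leading factor \<open>q ^ (3 ^ j)\<close> in the
  last equation is missing from the source's display; without it the continued fraction
  differs from the product as soon as the factor \<open>1 + q^9\<close> is present (at \<open>q = 2\<close>, \<open>n = 2\<close>
  it would be 14715/289 instead of 13851).
\<close>

fun ternary_num :: "'a::field \<Rightarrow> nat \<Rightarrow> 'a" where
  "ternary_num q 0 = q ^ 1"
| "ternary_num q (Suc 0) = (1 + q ^ 1) * q ^ 3"
| "ternary_num q (Suc (Suc j)) = q ^ (3 ^ j) * ((1 + q ^ (3 ^ (j + 1))) * q ^ (3 ^ (j + 2)))"

text \<open>The tail from level \<open>k\<close> of the continued fraction that ends with
  \<open>ternary_den q (n + 1)\<close>; these tails, for \<open>k \<le> n + 1\<close>, are exactly the quantities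
  one divides by.\<close>

definition ternary_tail :: "'a::field \<Rightarrow> nat \<Rightarrow> nat \<Rightarrow> 'a" where
  "ternary_tail q n k = cf_tail (ternary_num q) (ternary_den q) k (n + 1 - k)"

definition ternary_cf :: "'a::field \<Rightarrow> nat \<Rightarrow> 'a" where
  "ternary_cf q n = 1 / ternary_tail q n 0"

lemma ternary_cf_3:
  "ternary_cf q 3 =
     1 / (1 - q / (1 + q - (1 + q) * q^3 / (q + q^3 + q * q^3
       - q * ((1 + q^3) * q^9) / (q^3 + q^9 + q^3 * q^9
       - q^3 * ((1 + q^9) * q^27) / (q^9 + q^27 + q^9 * q^27)))))"
  by (simp add: ternary_cf_def ternary_tail_def numeral_eq_Suc)

definition indet :: "int poly fract" where
  "indet = Fract [:0, 1:] 1"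

end

theory Submission
  imports Defs "HOL-Computational_Algebra.Polynomial_Factorial"
begin

text \<open>
  Expanding the product \<open>\<Prod>i\<le>n. 1 + q ^ 3 ^ i\<close> selects a set of exponents \<open>i\<close>, which is the
  same thing as a partition into distinct powers of three; this gives the sum over \<open>p3D\<close> in
  every commutative semiring.

  The continued fraction is Euler's transformation of the telescoping series
  \<open>1 + (\<Sum>i\<le>n. (\<Prod>j<i. 1 + q ^ 3 ^ j) * q ^ 3 ^ i)\<close>, whose partial sums are the products.
  In Euler's transformation every tail is, up to an explicit factor, a quotient of two
  consecutive remainders of the series.  Here the remainder after the partial sum \<open>\<Prod>i<j. 1 + q ^ 3 ^ i\<close> is
  that partial sum times \<open>R j - 1\<close>, where \<open>R j = (\<Prod>i=j..n. 1 + q ^ 3 ^ i)\<close>.  For \<open>q \<noteq> 0\<close>, and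
  as long as the tails at deeper levels do not vanish, the tails are therefore
  \<open>1 / R 0\<close> at level \<open>0\<close>, \<open>q * R 0 / (R 0 - 1)\<close> at level \<open>1\<close>, and
  \<open>q ^ 3 ^ (j + 1) * (R j - 1) / (R (j + 1) - 1)\<close> at level \<open>j + 2\<close>
  (lemmas \<open>ternary_tail_zero\<close>, \<open>ternary_tail_one\<close>, \<open>ternary_tail_deep\<close>).
  Level \<open>0\<close> is the claimed value of the continued fraction.  The same formulas show that for
  \<open>q \<noteq> 0\<close> no tail vanishes exactly when \<open>R 0 \<noteq> 0\<close> and no \<open>R j\<close> with \<open>j \<le> n\<close> equals \<open>1\<close>
  (\<open>ternary_tails_nonzero_iff\<close>).  For an indeterminate this holds because the polynomial \<open>R j\<close>
  takes the value \<open>2 ^ (n + 1 - j)\<close> at \<open>1\<close>.  The value \<open>q = 0\<close> is separate: there the last tail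
  is \<open>0\<close> as soon as \<open>n > 0\<close>, and for \<open>n = 0\<close> both sides are \<open>1\<close>.
\<close>

section \<open>Expanding the product over ternary partitions\<close>

lemma distinct_ternary_partitions_eq:
  "distinct_ternary_partitions n k =
     (\<lambda>S. mset_set ((^) 3 ` S)) ` {S. S \<subseteq> {..n} \<and> (\<Sum>i\<in>S. 3 ^ i) = k}"
proof (intro equalityI subsetI)
  fix M assume "M \<in> distinct_ternary_partitions n k"
  then have M: "set_mset M \<subseteq> {3 ^ i | i. i \<le> n}" "\<And>y. count M y \<le> 1" "sum_mset M = k"
    by (auto simp: distinct_ternary_partitions_def)
  define S where "S = {i. i \<le> n \<and> 3 ^ i \<in># M}"
  have S_le: "S \<subseteq> {..n}"
    by (auto simp: S_def)
  have img: "(^) 3 ` S = set_mset M"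
    using M(1) by (auto simp: S_def)
  have "count M y = count (mset_set (set_mset M)) y" for y
    using M(2)[of y] by (cases "y \<in># M") (auto simp: count_eq_zero_iff le_Suc_eq)
  then have M_eq: "M = mset_set ((^) 3 ` S)"
    by (simp add: img multiset_eq_iff)
  have "(\<Sum>i\<in>S. 3 ^ i :: nat) = (\<Sum>y\<in>(^) 3 ` S. y)"
    by (simp add: sum.reindex inj_on_def)
  also have "\<dots> = k"
    using M(3) M_eq by (simp add: sum_unfold_sum_mset)
  finally show "M \<in> (\<lambda>S. mset_set ((^) 3 ` S)) ` {S. S \<subseteq> {..n} \<and> (\<Sum>i\<in>S. 3 ^ i) = k}"
    using M_eq S_le by blast
next
  fix M assume "M \<in> (\<lambda>S. mset_set ((^) (3 :: nat) ` S)) ` {S. S \<subseteq> {..n} \<and> (\<Sum>i\<in>S. 3 ^ i) = k}"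
  then obtain S where S: "S \<subseteq> {..n}" "(\<Sum>i\<in>S. 3 ^ i) = k" "M = mset_set ((^) 3 ` S)"
    by auto
  have fin: "finite S"
    using S(1) finite_subset by blast
  have "sum_mset M = (\<Sum>y\<in>(^) 3 ` S. y)"
    using S(3) by (simp add: sum_unfold_sum_mset)
  also have "\<dots> = k"
    using S(2) by (simp add: sum.reindex inj_on_def)
  finally show "M \<in> distinct_ternary_partitions n k"
    using S fin by (auto simp: distinct_ternary_partitions_def count_mset_set')
qed

lemma p3D_eq_card_subsets: "p3D n k = card {S. S \<subseteq> {..n} \<and> (\<Sum>i\<in>S. 3 ^ i) = k}"
proof -
  have "inj_on (\<lambda>S. mset_set ((^) (3::nat) ` S)) {S. S \<subseteq> {..n} \<and> (\<Sum>i\<in>S. 3 ^ i) = k}"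
  proof (rule inj_onI)
    fix S T
    assume "S \<in> {S. S \<subseteq> {..n} \<and> (\<Sum>i\<in>S. 3 ^ i) = k}" "T \<in> {S. S \<subseteq> {..n} \<and> (\<Sum>i\<in>S. 3 ^ i) = k}"
      and eq: "mset_set ((^) (3::nat) ` S) = mset_set ((^) 3 ` T)"
    then have "finite S" "finite T"
      using finite_subset[OF _ finite_atMost] by auto
    then have "(^) (3::nat) ` S = (^) 3 ` T"
      using eq by (metis finite_imageI finite_set_mset_mset_set)
    then show "S = T"
      by (subst (asm) inj_image_eq_iff) (auto simp: inj_on_def)
  qed
  then show ?thesis
    by (simp add: p3D_def distinct_ternary_partitions_eq card_image)
qed

lemma prod_eq_sum_p3D:
  fixes x :: "'a::comm_semiring_1"
  shows "(\<Prod>i\<le>n. 1 + x ^ (3 ^ i)) = (\<Sum>k = 0..3 ^ (n + 1) - 1. of_nat (p3D n k) * x ^ k)"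
proof -
  define w where "w S = (\<Sum>i\<in>S. 3 ^ i :: nat)" for S
  have geometric: "w {..n} \<le> 3 ^ (n + 1) - 1"
    unfolding w_def by (induction n) simp_all
  have bound: "w S \<le> 3 ^ (n + 1) - 1" if "S \<subseteq> {..n}" for S
    using geometric sum_mono2[of "{..n}" S "\<lambda>i. 3 ^ i :: nat"] that by (auto simp: w_def)
  have "(\<Prod>i\<le>n. 1 + x ^ (3 ^ i)) = (\<Prod>i\<le>n. x ^ (3 ^ i) + 1)"
    by (simp add: add.commute)
  also have "\<dots> = (\<Sum>S\<in>Pow {..n}. x ^ w S)"
    by (simp add: prod_add w_def power_sum)
  also have "\<dots> = (\<Sum>k = 0..3 ^ (n + 1) - 1. \<Sum>S | S \<in> Pow {..n} \<and> w S = k. x ^ w S)"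
    by (rule sum.group[symmetric]) (use bound in auto)
  also have "\<dots> = (\<Sum>k = 0..3 ^ (n + 1) - 1. of_nat (p3D n k) * x ^ k)"
    by (intro sum.cong) (simp_all add: p3D_eq_card_subsets w_def)
  finally show ?thesis .
qed

section \<open>Closed forms of the tails\<close>

definition upper_prod :: "'a::comm_semiring_1 \<Rightarrow> nat \<Rightarrow> nat \<Rightarrow> 'a" where
  "upper_prod q n j = (\<Prod>i=j..n. 1 + q ^ (3 ^ i))"

lemma upper_prod_rec:
  "j \<le> n \<Longrightarrow> upper_prod q n j = (1 + q ^ (3 ^ j)) * upper_prod q n (Suc j)"
  by (simp add: upper_prod_def prod.atLeast_Suc_atMost)

lemma upper_prod_last: "upper_prod q n n = 1 + q ^ (3 ^ n)"
  by (simp add: upper_prod_def)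

lemma ternary_tail_last: "ternary_tail q n (Suc n) = ternary_den q (Suc n)"
  by (simp add: ternary_tail_def)

lemma ternary_tail_rec:
  "k \<le> n \<Longrightarrow>
     ternary_tail q n k = ternary_den q k - ternary_num q k / ternary_tail q n (Suc k)"
  by (simp add: ternary_tail_def Suc_diff_le)

text \<open>
  The induction runs from the innermost level outwards.  With \<open>u = q ^ 3 ^ j\<close>,
  \<open>v = q ^ 3 ^ (j + 1)\<close> and \<open>R = upper_prod q n (j + 1)\<close>, the factor \<open>1 + v\<close> in the partial
  numerator turns \<open>upper_prod q n (j + 2) - 1\<close> into \<open>R - 1 - v\<close>, and what remains is
  \<open>(u + v + u * v) * (R - 1) - u * (R - 1 - v) = v * ((1 + u) * R - 1)\<close>.
\<close>

lemma ternary_tail_deep: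
  fixes q :: "'a::field"
  assumes "q \<noteq> 0" "j < n" "\<And>i. j < i \<Longrightarrow> i \<le> n \<Longrightarrow> upper_prod q n i \<noteq> 1"
  shows "ternary_tail q n (Suc (Suc j)) =
           q ^ (3 ^ Suc j) * (upper_prod q n j - 1) / (upper_prod q n (Suc j) - 1)"
  using assms(2,3)
proof (induction j rule: strict_inc_induct)
  case (base j)
  then show ?case
    using assms(1)
    by (simp add: ternary_tail_last upper_prod_rec[of j] upper_prod_last field_simps)
next
  case (step j)
  define u v w R R' where "u = q ^ (3 ^ j)" and "v = q ^ (3 ^ Suc j)"
    and "w = q ^ (3 ^ Suc (Suc j))"
    and "R = upper_prod q n (Suc j)" and "R' = upper_prod q n (Suc (Suc j))"
  have nz: "w \<noteq> 0" "R \<noteq> 1" "R' \<noteq> 1"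
    using assms(1) step.prems[of "Suc j"] step.prems[of "Suc (Suc j)"] step.hyps
    by (simp_all add: w_def R_def R'_def)
  have R_rec: "R = (1 + v) * R'"
    using step.hyps by (simp add: R_def R'_def v_def upper_prod_rec[of "Suc j"])
  have IH: "ternary_tail q n (Suc (Suc (Suc j))) = w * (R - 1) / (R' - 1)"
    using step.IH step.prems by (simp add: w_def R_def R'_def)
  have "ternary_tail q n (Suc (Suc j)) = (u + v + u * v) - u * ((1 + v) * w) / (w * (R - 1) / (R' - 1))"
    using step.hyps IH by (simp add: ternary_tail_rec[of "Suc (Suc j)"] u_def v_def w_def)
  also have "u * ((1 + v) * w) / (w * (R - 1) / (R' - 1)) = u * ((1 + v) * (R' - 1)) / (R - 1)"
    using nz by simp
  also have "(1 + v) * (R' - 1) = R - 1 - v"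
    by (simp add: R_rec algebra_simps)
  also have "(u + v + u * v) - u * (R - 1 - v) / (R - 1) = v * ((1 + u) * R - 1) / (R - 1)"
    using nz by (simp add: field_simps)
  finally show ?case
    using step.hyps by (simp add: R_def u_def v_def upper_prod_rec[of j])
qed

lemma ternary_tail_one:
  fixes q :: "'a::field"
  assumes "q \<noteq> 0" "\<And>i. i \<le> n \<Longrightarrow> upper_prod q n i \<noteq> 1"
  shows "ternary_tail q n 1 = q * upper_prod q n 0 / (upper_prod q n 0 - 1)"
proof (cases n)
  case 0
  then show ?thesis
    using assms(1) by (simp add: ternary_tail_last upper_prod_last)
next
  case (Suc m)
  define R R' where "R = upper_prod q n 0" and "R' = upper_prod q n (Suc 0)"
  have nz: "R \<noteq> 1" "R' \<noteq> 1"
    using assms(2)[of 0] assms(2)[of "Suc 0"] Suc by (simp_all add: R_def R'_def)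
  have R_rec: "R = (1 + q) * R'"
    by (simp add: R_def R'_def upper_prod_rec[of 0])
  have "ternary_tail q n 1 = (1 + q) - (1 + q) * q ^ 3 / (q ^ 3 * (R - 1) / (R' - 1))"
    using Suc assms ternary_tail_deep[of q 0 n]
    by (simp add: ternary_tail_rec[of "Suc 0"] R_def R'_def)
  also have "(1 + q) * q ^ 3 / (q ^ 3 * (R - 1) / (R' - 1)) = (1 + q) * (R' - 1) / (R - 1)"
    using nz assms(1) by simp
  also have "(1 + q) * (R' - 1) = R - 1 - q"
    by (simp add: R_rec algebra_simps)
  also have "(1 + q) - (R - 1 - q) / (R - 1) = q * R / (R - 1)"
    using nz by (simp add: field_simps)
  finally show ?thesis
    by (simp add: R_def)
qed

lemma ternary_tail_zero:
  fixes q :: "'a::field"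
  assumes "q \<noteq> 0" "\<And>i. i \<le> n \<Longrightarrow> upper_prod q n i \<noteq> 1" "upper_prod q n 0 \<noteq> 0"
  shows "ternary_tail q n 0 = 1 / upper_prod q n 0"
proof -
  let ?R = "upper_prod q n 0"
  have "ternary_tail q n 0 = 1 - q / (q * ?R / (?R - 1))"
    using ternary_tail_one[OF assms(1,2)] by (simp add: ternary_tail_rec[of 0])
  also have "\<dots> = 1 / ?R"
    using assms(1,3) by (simp add: field_simps)
  finally show ?thesis .
qed

section \<open>When the tails do not vanish\<close>

text \<open>
  If no tail vanishes, then \<open>upper_prod q n j \<noteq> 1\<close> propagates downwards from \<open>j = n\<close>, where it
  says \<open>q \<noteq> 0\<close>: the closed form at level \<open>j + 2\<close> needs this only for larger indices, and its
  numerator contains \<open>upper_prod q n j - 1\<close>.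
\<close>

lemma ternary_tails_nonzero_iff:
  fixes q :: "'a::field"
  assumes "q \<noteq> 0"
  shows "(\<forall>k\<le>n + 1. ternary_tail q n k \<noteq> 0) \<longleftrightarrow>
           upper_prod q n 0 \<noteq> 0 \<and> (\<forall>j\<le>n. upper_prod q n j \<noteq> 1)"
proof (intro iffI)
  assume tails: "\<forall>k\<le>n + 1. ternary_tail q n k \<noteq> 0"
  have ne1: "upper_prod q n j \<noteq> 1" if "j \<le> n" for j
    using that
  proof (induction "n - j" arbitrary: j rule: less_induct)
    case less
    show ?case
    proof (cases "j = n")
      case True
      then show ?thesis
        using assms by (simp add: upper_prod_last)
    next
      case False
      then have "j < n"
        using less.prems by simp
      moreover have "upper_prod q n i \<noteq> 1" if "j < i" "i \<le> n" for i
        using less.hyps that by simp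
      moreover have "ternary_tail q n (Suc (Suc j)) \<noteq> 0"
        using tails \<open>j < n\<close> by simp
      ultimately show ?thesis
        using ternary_tail_deep[OF assms, of j n] by auto
    qed
  qed
  moreover have "ternary_tail q n 1 \<noteq> 0"
    using tails by simp
  ultimately show "upper_prod q n 0 \<noteq> 0 \<and> (\<forall>j\<le>n. upper_prod q n j \<noteq> 1)"
    using ternary_tail_one[OF assms, of n] by auto
next
  assume R: "upper_prod q n 0 \<noteq> 0 \<and> (\<forall>j\<le>n. upper_prod q n j \<noteq> 1)"
  show "\<forall>k\<le>n + 1. ternary_tail q n k \<noteq> 0"
  proof (intro allI impI)
    fix k assume k: "k \<le> n + 1"
    consider "k = 0" | "k = 1" | j where "k = Suc (Suc j)"
      by (metis One_nat_def not0_implies_Suc)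
    then show "ternary_tail q n k \<noteq> 0"
    proof cases
      case 1
      then show ?thesis
        using ternary_tail_zero[OF assms, of n] R by simp
    next
      case 2
      then show ?thesis
        using ternary_tail_one[OF assms, of n] R assms by simp
    next
      case 3
      then show ?thesis
        using ternary_tail_deep[OF assms, of j n] R assms k by simp
    qed
  qed
qed

lemma ternary_cf_eq_prod:
  fixes q :: "'a::field"
  assumes tails: "\<forall>k\<le>n + 1. ternary_tail q n k \<noteq> 0"
  shows "ternary_cf q n = (\<Prod>i\<le>n. 1 + q ^ (3 ^ i))"
proof (cases "q = 0")
  case False
  then have "ternary_cf q n = upper_prod q n 0"
    using ternary_tails_nonzero_iff[OF False, of n] tails ternary_tail_zero[OF False, of n]
    by (simp add: ternary_cf_def)
  then show ?thesis
    by (simp add: upper_prod_def atLeast0AtMost)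
next
  case True
  have "ternary_den q (Suc n) \<noteq> 0"
    using tails ternary_tail_last[of q n] by (metis Suc_eq_plus1 order_refl)
  \<comment> \<open>At \<open>q = 0\<close> the innermost denominator is \<open>0\<close> unless it is the one at level \<open>1\<close>.\<close>
  then have "n = 0"
    using True by (cases n) (auto simp: power_0_left)
  then show ?thesis
    using True by (simp add: ternary_cf_def ternary_tail_def)
qed

lemma indet_eq_to_fract: "indet = to_fract [:0, 1:]"
  by (simp add: indet_def to_fract_def)

lemma upper_prod_to_fract: "upper_prod (to_fract p) n j = to_fract (upper_prod p n j)"
proof -
  have pow: "to_fract p ^ m = to_fract (p ^ m)" for m
    by (induction m) simp_all
  have "(\<Prod>i\<in>A. to_fract (f i)) = to_fract (\<Prod>i\<in>A. f i)" for A :: "nat set" and f :: "nat \<Rightarrow> 'a"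
    by (induction A rule: infinite_finite_induct) simp_all
  then show ?thesis
    by (simp add: upper_prod_def pow flip: to_fract_1 to_fract_add)
qed

lemma indet_tails_nonzero: "\<forall>k\<le>n + 1. ternary_tail indet n k \<noteq> 0"
proof -
  let ?R = "upper_prod [:0, 1 :: int:] n"
  have at_one: "poly (?R j) 1 = 2 ^ (Suc n - j)" for j
    by (simp add: upper_prod_def poly_prod)
  have "?R 0 \<noteq> 0"
    using at_one[of 0] by auto
  moreover have "?R j \<noteq> 1" if "j \<le> n" for j
  proof -
    have "(1 :: int) < 2 ^ (Suc n - j)"
      using that by (intro one_less_power) auto
    then have "poly (?R j) 1 \<noteq> poly 1 1"
      using at_one[of j] by (metis less_irrefl poly_1)
    then show ?thesis
      by metis
  qed
  moreover have "indet \<noteq> 0"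
    by (simp add: indet_eq_to_fract)
  ultimately show ?thesis
    using ternary_tails_nonzero_iff[of indet n]
    by (simp add: indet_eq_to_fract upper_prod_to_fract flip: to_fract_1)
qed

theorem corollary2p7:
  fixes n :: nat and x :: "'a::field"
  shows
    "(\<Prod>i\<le>n. 1 + indet ^ (3 ^ i)) = (\<Sum>k = 0..3 ^ (n + 1) - 1. of_nat (p3D n k) * indet ^ k)
     \<and> (\<forall>k\<le>n + 1. ternary_tail indet n k \<noteq> 0)
     \<and> (\<Sum>k = 0..3 ^ (n + 1) - 1. of_nat (p3D n k) * indet ^ k) = ternary_cf indet n
     \<and> (\<Prod>i\<le>n. 1 + x ^ (3 ^ i)) = (\<Sum>k = 0..3 ^ (n + 1) - 1. of_nat (p3D n k) * x ^ k)
     \<and> ((\<forall>k\<le>n + 1. ternary_tail x n k \<noteq> 0) \<longrightarrow>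
          (\<Sum>k = 0..3 ^ (n + 1) - 1. of_nat (p3D n k) * x ^ k) = ternary_cf x n)"
  using prod_eq_sum_p3D[of indet n] prod_eq_sum_p3D[of x n] indet_tails_nonzero[of n]
    ternary_cf_eq_prod[of n indet] ternary_cf_eq_prod[of n x]
  by metis

end
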